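(* Let $\beta>0$, $t\in\mathbb{R}$ with $t\ne0$, and let $\{Z(t)\}_{t\in\mathbb{R}}$ be the moving maximum process generated by the normal density $\phi(x)=\frac{\beta}{\sqrt{2\pi}}\exp\{-\beta^2x^2/2\}$. Let $\Phi$ be the standard normal distribution function and $\varphi=\Phi'$. Then for all $w_1,w_2>0$, $$-\log P\{Z(0)\le w_1,\ Z(t)\le w_2\}=\frac1{w_1}\Phi\left(\frac{\beta|t|}{2}+\frac1{\beta|t|}\log\frac{w_2}{w_1}\right)+\frac1{w_2}\Phi\left(\frac{\beta|t|}{2}+\frac1{\beta|t|}\log\frac{w_1}{w_2}\right),$$ and this quantity is also equal to each of the following two expressions. (i) $\displaystyle\int_0^{\pi/2}\max\left\{\frac{\sin\theta}{w_1},\frac{\cos\theta}{w_2}\right\}s(\theta)\,d\theta$, where $$s(\theta)=\frac1{\beta|t|\sin\theta\cos\theta}\left\{\frac1{\cos\theta}\left(\frac12-\frac{\ln(\tan\theta)}{t^2\beta^2}\right)\varphi\left(\frac{|t|\beta}{2}+\frac{\ln(\tan\theta)}{|t|\beta}\right)+\frac1{\sin\theta}\left(\frac12+\frac{\ln(\tan\theta)}{t^2\beta^2}\right)\varphi\left(\frac{|t|\beta}{2}-\frac{\ln(\tan\theta)}{|t|\beta}\right)\right\}.$$ (ii) $\dfrac1{w_1}+\dfrac1{w_2}+\dfrac1{w_2}\,\chi\!\left(\dfrac{w_2}{w_1}\right)$, where for $s>0$ $$\chi(s)=-s\,\Phi\left(-\frac{|t|\beta}{2}-\frac1{|t|\beta}\ln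 s\right)-\Phi\left(-\frac{|t|\beta}{2}+\frac1{|t|\beta}\ln s\right).$$
   Context: For a unimodal continuous probability density $\phi$ on $\mathbb{R}$, let $\{(X_j,Y_j)\}_{j\ge1}$ be the points of a homogeneous (unit intensity) Poisson process on $\mathbb{R}\times\mathbb{R}_+$. The moving maximum process generated by $\phi$ is $$Z(t):=\max_{j\ge1}\frac{\phi(X_j-t)}{Y_j},\qquad t\in\mathbb{R}.$$ It is stationary and simple max-stable, with finite-dimensional distributions $$P\{Z(t_1)\le x_1,\dots,Z(t_d)\le x_d\}=\exp\left\{-\int_{-\infty}^{\infty}\max_{1\le i\le d}\frac{\phi(s-t_i)}{x_i}\,ds\right\},\qquad t_i\in\mathbb{R},\ x_i>0.$$ *)

theory Defs
  imports "HOL-Probability.Probability"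
begin

text \<open>
  The point process is given by an enumeration of its points; \<open>num_points P A \<omega>\<close> counts, with
  multiplicity, those lying in \<open>A\<close>.
\<close>

definition num_points :: "(nat \<Rightarrow> 'a \<Rightarrow> 'b) \<Rightarrow> 'b set \<Rightarrow> 'a \<Rightarrow> ennreal" where
  "num_points P A \<omega> = emeasure (count_space UNIV) {j. P j \<omega> \<in> A}"

definition poisson_process :: "'a measure \<Rightarrow> 'b measure \<Rightarrow> (nat \<Rightarrow> 'a \<Rightarrow> 'b) \<Rightarrow> bool" where
  "poisson_process M \<mu> P \<longleftrightarrow>
     prob_space M \<and>
     (\<forall>j. P j \<in> measurable M \<mu>) \<and>
     (\<forall>A\<in>sets \<mu>. emeasure \<mu> A < \<infinity> \<longrightarrow>
        (\<forall>k::nat. measure M {\<omega> \<in> space M. num_points P A \<omega> = of_nat k}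
                  = exp (- measure \<mu> A) * measure \<mu> A ^ k / fact k)) \<and>
     (\<forall>(I :: nat set) A. finite I \<longrightarrow> A ` I \<subseteq> sets \<mu> \<longrightarrow> disjoint_family_on A I \<longrightarrow>
        prob_space.indep_vars M (\<lambda>_. borel) (\<lambda>i. num_points P (A i)) I)"

text \<open>
  The half-line of second coordinates is taken to be open: the points with second coordinate
  \<open>0\<close> form a null set, and excluding them avoids division by zero below.
\<close>

definition half_plane_lebesgue :: "(real \<times> real) measure" where
  "half_plane_lebesgue = restrict_space lborel (UNIV \<times> {0<..})"

text \<open>
  The maximum over the infinitely many points is written as a supremum in the extended reals,
  which exists on every sample path. It coincides with the maximum whenever the latter is
  attained, which for a continuous unimodal density \<open>f\<close> and fixed \<open>t\<close> is almost surely the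
  case.
\<close>

definition moving_maximum ::
    "(real \<Rightarrow> real) \<Rightarrow> (nat \<Rightarrow> 'a \<Rightarrow> real) \<Rightarrow> (nat \<Rightarrow> 'a \<Rightarrow> real) \<Rightarrow> real \<Rightarrow> 'a \<Rightarrow> ereal" where
  "moving_maximum f X Y t \<omega> = (SUP j. ereal (f (X j \<omega> - t) / Y j \<omega>))"

definition gauss_density :: "real \<Rightarrow> real \<Rightarrow> real" where
  "gauss_density \<beta> x = \<beta> / sqrt (2 * pi) * exp (- (\<beta>\<^sup>2 * x\<^sup>2) / 2)"

definition std_normal_cdf :: "real \<Rightarrow> real" where
  "std_normal_cdf = cdf std_normal_distribution"

definition std_normal_pdf :: "real \<Rightarrow> real" where
  "std_normal_pdf = deriv std_normal_cdf"

definition spectral_density :: "real \<Rightarrow> real \<Rightarrow> real \<Rightarrow> real" where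
  "spectral_density \<beta> t \<theta> =
     1 / (\<beta> * \<bar>t\<bar> * sin \<theta> * cos \<theta>) *
     (1 / cos \<theta> * (1 / 2 - ln (tan \<theta>) / (t\<^sup>2 * \<beta>\<^sup>2))
        * std_normal_pdf (\<bar>t\<bar> * \<beta> / 2 + ln (tan \<theta>) / (\<bar>t\<bar> * \<beta>))
      + 1 / sin \<theta> * (1 / 2 + ln (tan \<theta>) / (t\<^sup>2 * \<beta>\<^sup>2))
        * std_normal_pdf (\<bar>t\<bar> * \<beta> / 2 - ln (tan \<theta>) / (\<bar>t\<bar> * \<beta>)))"

definition chi :: "real \<Rightarrow> real \<Rightarrow> real \<Rightarrow> real" where
  "chi \<beta> t s =
     - s * std_normal_cdf (- (\<bar>t\<bar> * \<beta> / 2) - 1 / (\<bar>t\<bar> * \<beta>) * ln s)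
     - std_normal_cdf (- (\<bar>t\<bar> * \<beta> / 2) + 1 / (\<bar>t\<bar> * \<beta>) * ln s)"

end

theory Submission
  imports Defs
begin

text \<open>
  The event \<open>Z 0 \<le> w\<^sub>1 \<and> Z t \<le> w\<^sub>2\<close> says that no point of the process lies below the graph of
  the function \<open>x \<mapsto> max (f x / w\<^sub>1) (f (x - t) / w\<^sub>2)\<close>, so \<open>V\<close> is the area of that region. An
  affine substitution turns the area into the integral of
  \<open>max (p * \<phi> u) (q * \<phi> (u - a))\<close> with \<open>\<phi>\<close> the standard normal density and \<open>a = \<beta> * \<bar>t\<bar>\<close>, and
  the two functions under the maximum cross at a single point. The two summands of the spectral
  density combine to \<open>\<phi> (a / 2 + ln (tan \<theta>) / a) / (a * sin \<theta> * (cos \<theta>)\<^sup>2)\<close>, and the substitution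
  \<open>u = a / 2 + ln (tan \<theta>) / a\<close> maps the spectral integral to the same integral.
\<close>

section \<open>The standard normal density and distribution function\<close>

text \<open>Completing the square. The ratio of the shifted to the unshifted density is an
  exponential in \<open>u\<close>, which locates the crossing point of two scaled densities and
  later relates the two densities inside \<open>spectral_density\<close>.\<close>

lemma std_normal_density_shift:
  "std_normal_density (u - a) = exp (a * u - a\<^sup>2 / 2) * std_normal_density u"
proof -
  have "- (u - a)\<^sup>2 / 2 = (a * u - a\<^sup>2 / 2) + - u\<^sup>2 / 2"
    by (simp add: power2_eq_square field_simps)
  then show ?thesis
    unfolding std_normal_density_def by (simp only: exp_add mult_ac)
qed

lemma std_normal_density_minus: "std_normal_density (- u) = std_normal_density u"
  by (simp add: std_normal_density_def)

text \<open>The form \<open>has_bochner_integral\<close> carries integrability together with the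
  value, so the later substitutions and sums need no separate integrability arguments.\<close>

lemma has_bochner_integral_std_normal_density_atMost:
  "has_bochner_integral lborel (\<lambda>u. indicator {..x} u * std_normal_density u) (std_normal_cdf x)"
proof -
  have "emeasure std_normal_distribution {..x}
      = (\<integral>\<^sup>+u. ennreal (indicator {..x} u * std_normal_density u) \<partial>lborel)"
    by (subst emeasure_density)
       (auto intro!: nn_integral_cong simp: ennreal_mult' mult.commute split: split_indicator)
  moreover interpret real_distribution std_normal_distribution
    by (rule real_dist_normal_dist)
  have "emeasure std_normal_distribution {..x} = ennreal (std_normal_cdf x)"
    by (simp add: std_normal_cdf_def cdf_def emeasure_eq_measure)
  ultimately show ?thesis
    by (intro has_bochner_integral_nn_integral) (auto simp: std_normal_cdf_def cdf_def)
qed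

lemma has_bochner_integral_std_normal_density:
  "has_bochner_integral lborel std_normal_density 1"
  by (simp add: has_bochner_integral_iff integral_normal_density integrable_normal_density)

lemma has_bochner_integral_std_normal_density_greaterThan:
  "has_bochner_integral lborel (\<lambda>u. indicator {x<..} u * std_normal_density u) (1 - std_normal_cdf x)"
proof -
  have "has_bochner_integral lborel
      (\<lambda>u. std_normal_density u - indicator {..x} u * std_normal_density u) (1 - std_normal_cdf x)"
    by (intro has_bochner_integral_diff has_bochner_integral_std_normal_density
        has_bochner_integral_std_normal_density_atMost)
  also have "(\<lambda>u. std_normal_density u - indicator {..x} u * std_normal_density u)
      = (\<lambda>u. indicator {x<..} u * std_normal_density u)"
    by (auto simp: fun_eq_iff split: split_indicator)
  finally show ?thesis .
qed

text \<open>The reflection \<open>u \<mapsto> - u\<close> preserves the even density and turns the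
  lower tail at \<open>- x\<close> into the upper tail at \<open>x\<close>; the endpoint
  \<open>x\<close> is a null set.\<close>

lemma std_normal_cdf_minus: "std_normal_cdf (- x) = 1 - std_normal_cdf x"
proof -
  have "has_bochner_integral lborel (\<lambda>u. indicator {..- x} (0 + (- 1) * u) * std_normal_density (0 + (- 1) * u))
      (std_normal_cdf (- x) /\<^sub>R \<bar>- 1\<bar>)"
    by (subst lborel_has_bochner_integral_real_affine_iff[symmetric])
       (auto intro: has_bochner_integral_std_normal_density_atMost)
  then have "has_bochner_integral lborel (\<lambda>u. indicator {x..} u * std_normal_density u)
      (std_normal_cdf (- x))"
    by (simp add: std_normal_density_minus indicator_def)
  moreover have "AE u in lborel. indicator {x<..} u * std_normal_density u
      = indicator {x..} u * std_normal_density u"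
    using AE_lborel_singleton[of x] by eventually_elim (auto simp: indicator_def)
  ultimately have "has_bochner_integral lborel (\<lambda>u. indicator {x<..} u * std_normal_density u)
      (std_normal_cdf (- x))"
    by (subst has_bochner_integral_cong_AE) auto
  from has_bochner_integral_eq[OF this has_bochner_integral_std_normal_density_greaterThan]
  show ?thesis .
qed

lemma has_integral_std_normal_density_atMost:
  "(std_normal_density has_integral std_normal_cdf x) {..x}"
proof -
  have "((\<lambda>u. indicator {..x} u * std_normal_density u) has_integral std_normal_cdf x) UNIV"
    using has_bochner_integral_std_normal_density_atMost[of x]
      has_integral_integral_lborel[of "\<lambda>u. indicator {..x} u * std_normal_density u"]
    by (simp add: has_bochner_integral_iff)
  moreover have "(\<lambda>u. indicator {..x} u * std_normal_density u)
      = (\<lambda>u. if u \<in> {..x} then std_normal_density u else 0)"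
    by (auto simp: fun_eq_iff)
  ultimately show ?thesis
    by (simp only: has_integral_restrict_UNIV)
qed

lemma continuous_on_std_normal_density: "continuous_on A std_normal_density"
  unfolding std_normal_density_def by (intro continuous_intros) auto

text \<open>Near \<open>x\<close> the distribution function is a constant plus an integral with
  fixed lower limit, so the fundamental theorem of calculus applies.\<close>

lemma std_normal_cdf_has_real_derivative:
  "(std_normal_cdf has_real_derivative std_normal_density x) (at x)"
proof -
  \<comment> \<open>The lower limit \<open>x - 1\<close> is an arbitrary choice that makes
    \<open>x\<close> an interior point of a compact interval.\<close>
  have eq: "std_normal_cdf (x - 1) + integral {x - 1..y} std_normal_density = std_normal_cdf y"
    if "y \<in> {x - 1..x + 1}" for y
  proof -
    have "(std_normal_density has_integral
        std_normal_cdf (x - 1) + integral {x - 1..y} std_normal_density) ({..x - 1} \<union> {x - 1..y})"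
      using that by (intro has_integral_Un has_integral_std_normal_density_atMost integrable_integral
          integrable_continuous_interval continuous_on_std_normal_density)
        (auto intro: negligible_subset[of "{x - 1}"])
    moreover have "{..x - 1} \<union> {x - 1..y} = {..y}"
      using that by auto
    ultimately show ?thesis
      using has_integral_std_normal_density_atMost[of y] has_integral_unique by metis
  qed
  have "((\<lambda>y. std_normal_cdf (x - 1) + integral {x - 1..y} std_normal_density)
      has_real_derivative 0 + std_normal_density x) (at x within {x - 1..x + 1})"
    by (intro DERIV_add DERIV_const integral_has_real_derivative continuous_on_std_normal_density) auto
  then have "(std_normal_cdf has_real_derivative std_normal_density x) (at x within {x - 1..x + 1})"
    using eq by (subst (asm) has_field_derivative_cong_eventually[where g = std_normal_cdf])
      (auto simp: eventually_at_filter)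
  then show ?thesis
    by (simp add: at_within_Icc_at)
qed

lemma std_normal_pdf_eq_density: "std_normal_pdf = std_normal_density"
  unfolding std_normal_pdf_def using std_normal_cdf_has_real_derivative
  by (auto simp: fun_eq_iff intro: DERIV_imp_deriv)

section \<open>The area under the maximum of two scaled normal densities\<close>

text \<open>Since \<open>a > 0\<close>, the unshifted term dominates up to a single crossing point
  \<open>c\<close> and the shifted one beyond it. The integral is thus a lower tail at
  \<open>c\<close> plus an upper tail at \<open>c - a\<close>, and the latter is reflected into a
  value of the distribution function.\<close>

lemma has_bochner_integral_max_std_normal_density:
  fixes p q a :: real
  assumes "p > 0" "q > 0" "a > 0"
  shows "has_bochner_integral lborel (\<lambda>u. max (p * std_normal_density u) (q * std_normal_density (u - a)))
     (p * std_normal_cdf (a / 2 + ln (p / q) / a) + q * std_normal_cdf (a / 2 + ln (q / p) / a))"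
proof -
  \<comment> \<open>Solution in \<open>u\<close> of
    \<open>a * u - a\<^sup>2 / 2 = ln (p / q)\<close>, where the two terms are equal.\<close>
  define c where "c = a / 2 + ln (p / q) / a"
  have c': "a / 2 + ln (q / p) / a = - (c - a)"
    using assms by (simp add: c_def ln_div field_simps)
  have crossing: "q * std_normal_density (u - a) \<le> p * std_normal_density u \<longleftrightarrow> u \<le> c" for u
  proof -
    have "q * std_normal_density (u - a) \<le> p * std_normal_density u
        \<longleftrightarrow> (q * exp (a * u - a\<^sup>2 / 2)) * std_normal_density u \<le> p * std_normal_density u"
      by (simp add: std_normal_density_shift mult.assoc)
    also have "\<dots> \<longleftrightarrow> q * exp (a * u - a\<^sup>2 / 2) \<le> p"
      by (subst mult_le_cancel_right_pos) (auto simp: normal_density_pos)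
    also have "\<dots> \<longleftrightarrow> exp (a * u - a\<^sup>2 / 2) \<le> exp (ln (p / q))"
      using assms by (simp add: field_simps)
    also have "\<dots> \<longleftrightarrow> a * u - a\<^sup>2 / 2 \<le> ln (p / q)"
      by simp
    also have "\<dots> \<longleftrightarrow> u \<le> c"
      using assms by (simp add: c_def field_simps power2_eq_square)
    finally show ?thesis .
  qed
  have "has_bochner_integral lborel
      (\<lambda>u. indicator {c - a<..} (- a + 1 * u) * std_normal_density (- a + 1 * u))
      ((1 - std_normal_cdf (c - a)) /\<^sub>R \<bar>1\<bar>)"
    by (subst lborel_has_bochner_integral_real_affine_iff[symmetric])
       (auto intro: has_bochner_integral_std_normal_density_greaterThan)
  then have right: "has_bochner_integral lborel (\<lambda>u. indicator {c<..} u * std_normal_density (u - a))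
      (std_normal_cdf (- (c - a)))"
    unfolding std_normal_cdf_minus by (simp add: indicator_def)
  have "has_bochner_integral lborel
      (\<lambda>u. p * (indicator {..c} u * std_normal_density u)
         + q * (indicator {c<..} u * std_normal_density (u - a)))
      (p * std_normal_cdf c + q * std_normal_cdf (- (c - a)))"
    by (intro has_bochner_integral_add has_bochner_integral_mult_right
        has_bochner_integral_std_normal_density_atMost right)
  also have "(\<lambda>u. p * (indicator {..c} u * std_normal_density u)
         + q * (indicator {c<..} u * std_normal_density (u - a)))
      = (\<lambda>u. max (p * std_normal_density u) (q * std_normal_density (u - a)))"
  proof
    fix u
    show "p * (indicator {..c} u * std_normal_density u)
         + q * (indicator {c<..} u * std_normal_density (u - a))
      = max (p * std_normal_density u) (q * std_normal_density (u - a))"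
      using crossing[of u] by (cases "u \<le> c") auto
  qed
  finally show ?thesis
    unfolding c' by (simp add: c_def)
qed

text \<open>Either sign of \<open>c\<close> is allowed, by evenness; the orientation of the
  substitution can then follow the sign of \<open>t\<close>.\<close>

lemma gauss_density_eq:
  assumes "\<beta> > 0" "\<bar>c\<bar> = \<beta>"
  shows "gauss_density \<beta> x = \<beta> * std_normal_density (c * x)"
proof -
  have "c\<^sup>2 = \<beta>\<^sup>2"
    using assms(2) by (metis power2_abs)
  then show ?thesis
    by (simp add: gauss_density_def std_normal_density_def power_mult_distrib)
qed

lemma has_bochner_integral_max_gauss_density:
  assumes "\<beta> > 0" "t \<noteq> 0" "w\<^sub>1 > 0" "w\<^sub>2 > 0"
  shows "has_bochner_integral lborel
      (\<lambda>x. max (gauss_density \<beta> x / w\<^sub>1) (gauss_density \<beta> (x - t) / w\<^sub>2))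
      (1 / w\<^sub>1 * std_normal_cdf (\<beta> * \<bar>t\<bar> / 2 + 1 / (\<beta> * \<bar>t\<bar>) * ln (w\<^sub>2 / w\<^sub>1))
        + 1 / w\<^sub>2 * std_normal_cdf (\<beta> * \<bar>t\<bar> / 2 + 1 / (\<beta> * \<bar>t\<bar>) * ln (w\<^sub>1 / w\<^sub>2)))"
    (is "has_bochner_integral _ ?f ?V")
proof -
  \<comment> \<open>With this sign the substitution \<open>u = c * x\<close> turns the shift by
    \<open>t\<close> into the positive shift \<open>\<beta> * \<bar>t\<bar>\<close>. Its Jacobian
    \<open>1 / \<beta>\<close> cancels the factor \<beta> of the density.\<close>
  define c where "c = sgn t * \<beta>"
  define H where "H = (\<lambda>u. max (1 / w\<^sub>1 * std_normal_density u)
    (1 / w\<^sub>2 * std_normal_density (u - \<beta> * \<bar>t\<bar>)))"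
  have c: "\<bar>c\<bar> = \<beta>" "c \<noteq> 0"
    using assms by (auto simp: c_def abs_mult sgn_if)
  have ct: "c * t = \<beta> * \<bar>t\<bar>"
    by (simp add: c_def sgn_if abs_if)
  have "has_bochner_integral lborel H ?V"
    unfolding H_def using has_bochner_integral_max_std_normal_density[of "1 / w\<^sub>1" "1 / w\<^sub>2" "\<beta> * \<bar>t\<bar>"] assms
    by simp
  then have "has_bochner_integral lborel (\<lambda>x. H (0 + c * x)) (?V /\<^sub>R \<bar>c\<bar>)"
    using c by (subst lborel_has_bochner_integral_real_affine_iff[symmetric]) auto
  then have "has_bochner_integral lborel (\<lambda>x. \<beta> * H (0 + c * x)) (\<beta> * (?V /\<^sub>R \<bar>c\<bar>))"
    by (rule has_bochner_integral_mult_right)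
  moreover have "\<beta> * (?V /\<^sub>R \<bar>c\<bar>) = ?V"
    using c assms by simp
  moreover have "(\<lambda>x. \<beta> * H (0 + c * x)) = ?f"
    using assms c ct
    by (auto simp: fun_eq_iff H_def gauss_density_eq[of \<beta> c] right_diff_distrib max_mult_distrib_left)
  ultimately show ?thesis
    by metis
qed

section \<open>From the Poisson process to the bivariate distribution\<close>

text \<open>Tonelli: the slice of the region over \<open>x\<close> is the interval
  \<open>{0<..<f x}\<close>, of length \<open>f x\<close>.\<close>

lemma emeasure_half_plane_under_graph:
  assumes "\<And>x. 0 \<le> f x" and "has_bochner_integral lborel f V"
  shows "{z. 0 < snd z \<and> snd z < f (fst z)} \<in> sets half_plane_lebesgue"
    and "emeasure half_plane_lebesgue {z. 0 < snd z \<and> snd z < f (fst z)} = ennreal V"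
proof -
  let ?A = "{z :: real \<times> real. 0 < snd z \<and> snd z < f (fst z)}"
  have [measurable]: "f \<in> borel_measurable borel"
    using borel_measurable_has_bochner_integral[OF assms(2)] by simp
  have "{z \<in> space (lborel \<Otimes>\<^sub>M lborel). 0 < snd z \<and> snd z < f (fst z)} \<in> sets (lborel \<Otimes>\<^sub>M lborel)"
    by measurable
  then have A: "?A \<in> sets (lborel \<Otimes>\<^sub>M lborel)"
    by (simp add: space_pair_measure)
  then have A': "?A \<in> sets lborel"
    unfolding lborel_prod .
  have S: "(UNIV :: real set) \<times> {0 :: real<..} \<in> sets lborel"
    by (simp add: open_Times)
  show "?A \<in> sets half_plane_lebesgue"
    unfolding half_plane_lebesgue_def using S A' by (subst sets_restrict_space_iff) auto
  have "emeasure half_plane_lebesgue ?A = emeasure lborel ?A"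
    unfolding half_plane_lebesgue_def using S by (intro emeasure_restrict_space) auto
  also have "\<dots> = (\<integral>\<^sup>+x. emeasure lborel (Pair x -` ?A) \<partial>lborel)"
    using A by (subst lborel_prod[symmetric], subst lborel.emeasure_pair_measure_alt) auto
  also have "\<dots> = (\<integral>\<^sup>+x. ennreal (f x) \<partial>lborel)"
  proof (intro nn_integral_cong)
    fix x
    have "Pair x -` ?A = {0<..<f x}"
      by auto
    then show "emeasure lborel (Pair x -` ?A) = ennreal (f x)"
      using assms(1)[of x] by simp
  qed
  also have "\<dots> = ennreal V"
    using assms by (simp add: has_bochner_integral_iff nn_integral_eq_integral)
  finally show "emeasure half_plane_lebesgue ?A = ennreal V" .
qed

text \<open>This is the Poisson probability of the count \<open>k = 0\<close>; a counting measure
  vanishes only on the empty index set.\<close>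

lemma poisson_process_void_probability:
  assumes "poisson_process M \<mu> P" "A \<in> sets \<mu>" "emeasure \<mu> A < \<infinity>"
  shows "measure M {\<omega> \<in> space M. \<forall>j. P j \<omega> \<notin> A} = exp (- measure \<mu> A)"
proof -
  have "measure M {\<omega> \<in> space M. num_points P A \<omega> = of_nat 0}
      = exp (- measure \<mu> A) * measure \<mu> A ^ 0 / fact 0"
    using assms unfolding poisson_process_def by blast
  moreover have "num_points P A \<omega> = of_nat 0 \<longleftrightarrow> (\<forall>j. P j \<omega> \<notin> A)" for \<omega>
    unfolding num_points_def by (subst of_nat_0, subst emeasure_count_space_eq_0) auto
  ultimately show ?thesis
    by simp
qed

text \<open>A supremum is bounded by \<open>w\<close> exactly when every term is, and positivity of
  \<open>Y j \<omega>\<close> and \<open>w\<close> allows them to be exchanged in each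
  inequality.\<close>

lemma moving_maximum_le_iff:
  assumes "\<And>j. Y j \<omega> > 0" "w > 0"
  shows "moving_maximum f X Y t \<omega> \<le> ereal w \<longleftrightarrow> (\<forall>j. f (X j \<omega> - t) / w \<le> Y j \<omega>)"
  using assms by (auto simp: moving_maximum_def SUP_le_iff field_simps)

lemma moving_maximum_bivariate_cdf:
  assumes P: "poisson_process M half_plane_lebesgue (\<lambda>j \<omega>. (X j \<omega>, Y j \<omega>))"
    and f: "\<And>x. 0 \<le> f x" and w: "w\<^sub>1 > 0" "w\<^sub>2 > 0"
    and V: "has_bochner_integral lborel (\<lambda>x. max (f (x - s) / w\<^sub>1) (f (x - t) / w\<^sub>2)) V"
  shows "measure M {\<omega> \<in> space M. moving_maximum f X Y s \<omega> \<le> ereal w\<^sub>1 \<and>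
      moving_maximum f X Y t \<omega> \<le> ereal w\<^sub>2} = exp (- V)"
proof -
  define h where "h = (\<lambda>x. max (f (x - s) / w\<^sub>1) (f (x - t) / w\<^sub>2))"
  \<comment> \<open>The upper inequality is strict because the event asks for \<open>\<le>\<close>:
    points on the graph of \<open>h\<close> are permitted.\<close>
  define A where "A = {z. 0 < snd z \<and> snd z < h (fst z)}"
  have h: "0 \<le> h x" for x
    using f[of "x - s"] w by (simp add: h_def le_max_iff_disj)
  have hV: "has_bochner_integral lborel h V"
    using V by (simp add: h_def)
  \<comment> \<open>Needed to recover \<open>V\<close> from \<open>ennreal V\<close>, since
    \<open>ennreal\<close> sends negative reals to \<open>0\<close>.\<close>
  have "0 \<le> V"
    using h hV by (auto simp: has_bochner_integral_iff)
  note A = emeasure_half_plane_under_graph[OF h hV, folded A_def]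
  \<comment> \<open>Positivity holds at every sample point, not just almost surely: a measurable map
    takes values in the space of its target, here the open half-plane.\<close>
  have Y: "Y j \<omega> > 0" if "\<omega> \<in> space M" for j \<omega>
  proof -
    have "(\<lambda>\<omega>. (X j \<omega>, Y j \<omega>)) \<in> measurable M half_plane_lebesgue"
      using P unfolding poisson_process_def by blast
    from measurable_space[OF this that] show ?thesis
      by (simp add: half_plane_lebesgue_def space_restrict_space)
  qed
  have "{\<omega> \<in> space M. moving_maximum f X Y s \<omega> \<le> ereal w\<^sub>1 \<and> moving_maximum f X Y t \<omega> \<le> ereal w\<^sub>2}
      = {\<omega> \<in> space M. \<forall>j. (X j \<omega>, Y j \<omega>) \<notin> A}"
  proof (intro Collect_cong conj_cong refl)
    fix \<omega>
    assume "\<omega> \<in> space M"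
    then show "moving_maximum f X Y s \<omega> \<le> ereal w\<^sub>1 \<and> moving_maximum f X Y t \<omega> \<le> ereal w\<^sub>2
        \<longleftrightarrow> (\<forall>j. (X j \<omega>, Y j \<omega>) \<notin> A)"
      using Y[of \<omega>] w by (auto simp: moving_maximum_le_iff A_def h_def not_less)
  qed
  also have "measure M \<dots> = exp (- measure half_plane_lebesgue A)"
    using A by (intro poisson_process_void_probability[OF P]) auto
  also have "measure half_plane_lebesgue A = V"
    using A(2) \<open>0 \<le> V\<close> by (simp add: measure_def)
  finally show ?thesis .
qed

section \<open>The spectral representation\<close>

text \<open>At \<open>u = a / 2 + ln (tan \<theta>) / a\<close> the exponent of the shift formula is
  \<open>ln (tan \<theta>)\<close>, so shifting by \<open>a\<close> multiplies the density by
  \<open>tan \<theta>\<close>. Both summands of \<open>spectral_density\<close> then share the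
  factor \<open>1 / cos \<theta>\<close> and the same density, and their coefficients add up to
  \<open>1\<close>.\<close>

lemma spectral_density_eq:
  fixes \<theta> :: real
  assumes "\<beta> > 0" "t \<noteq> 0" "\<theta> \<in> {0<..<pi / 2}"
  defines "a \<equiv> \<beta> * \<bar>t\<bar>"
  shows "spectral_density \<beta> t \<theta> = std_normal_density (a / 2 + ln (tan \<theta>) / a) / (a * sin \<theta> * (cos \<theta>)\<^sup>2)"
    and "std_normal_density (a / 2 + ln (tan \<theta>) / a - a)
      = tan \<theta> * std_normal_density (a / 2 + ln (tan \<theta>) / a)"
proof -
  define L where "L = ln (tan \<theta>)"
  define D where "D = std_normal_density (a / 2 + L / a)"
  have a: "a > 0"
    using assms by simp
  have sc: "sin \<theta> > 0" "cos \<theta> > 0" "tan \<theta> > 0"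
    using assms by (auto simp: sin_gt_zero cos_gt_zero tan_gt_zero)
  have "a * (a / 2 + L / a) - a\<^sup>2 / 2 = L"
    using a by (simp add: field_simps power2_eq_square)
  then have shift: "std_normal_density (a / 2 + L / a - a) = tan \<theta> * D"
    unfolding std_normal_density_shift D_def using sc by (simp add: L_def)
  then show "std_normal_density (a / 2 + ln (tan \<theta>) / a - a)
      = tan \<theta> * std_normal_density (a / 2 + ln (tan \<theta>) / a)"
    unfolding D_def L_def .
  \<comment> \<open>By evenness, the argument in the second summand of
    \<open>spectral_density\<close> may be replaced by the shifted one.\<close>
  have "a / 2 - L / a = - (a / 2 + L / a - a)"
    by simp
  then have "std_normal_density (a / 2 - L / a) = tan \<theta> * D"
    using shift by (simp only: std_normal_density_minus)
  moreover have "\<bar>t\<bar> * \<beta> = a" "t\<^sup>2 * \<beta>\<^sup>2 = a\<^sup>2"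
    by (simp_all add: a_def power_mult_distrib)
  ultimately have "spectral_density \<beta> t \<theta> = 1 / (a * sin \<theta> * cos \<theta>) *
      (1 / cos \<theta> * (1 / 2 - L / a\<^sup>2) * D + 1 / sin \<theta> * (1 / 2 + L / a\<^sup>2) * (tan \<theta> * D))"
    by (simp add: spectral_density_def std_normal_pdf_eq_density L_def D_def flip: a_def)
  also have "1 / sin \<theta> * (1 / 2 + L / a\<^sup>2) * (tan \<theta> * D) = 1 / cos \<theta> * (1 / 2 + L / a\<^sup>2) * D"
    using sc by (simp add: tan_def)
  also have "1 / cos \<theta> * (1 / 2 - L / a\<^sup>2) * D + 1 / cos \<theta> * (1 / 2 + L / a\<^sup>2) * D = D / cos \<theta>"
    by (simp add: distrib_right left_diff_distrib distrib_left right_diff_distrib)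
  finally show "spectral_density \<beta> t \<theta>
      = std_normal_density (a / 2 + ln (tan \<theta>) / a) / (a * sin \<theta> * (cos \<theta>)\<^sup>2)"
    by (simp add: D_def L_def power2_eq_square mult_ac)
qed

text \<open>On this interval \<open>tan\<close> is a bijection onto the positive reals,
  \<open>ln\<close> maps these onto the whole line, and an affine bijection follows. The inverse
  undoes the three maps in turn.\<close>

lemma bij_betw_ln_tan:
  fixes a b :: real
  assumes "a > 0"
  shows "bij_betw (\<lambda>\<theta>. b + ln (tan \<theta>) / a) {0<..<pi / 2} UNIV"
proof (rule bij_betwI[where g = "\<lambda>u. arctan (exp (a * (u - b)))"])
  show "(\<lambda>u. arctan (exp (a * (u - b)))) \<in> UNIV \<rightarrow> {0<..<pi / 2}"
    using arctan_ubound by auto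
qed (use assms in \<open>auto simp: tan_arctan tan_gt_zero arctan_tan\<close>)

lemma has_real_derivative_ln_tan:
  fixes a b \<theta> :: real
  assumes "a > 0" "\<theta> \<in> {0<..<pi / 2}"
  shows "((\<lambda>\<theta>. b + ln (tan \<theta>) / a) has_real_derivative 1 / (a * sin \<theta> * cos \<theta>)) (at \<theta> within A)"
proof -
  have sc: "sin \<theta> > 0" "cos \<theta> > 0" "tan \<theta> > 0"
    using assms by (auto simp: sin_gt_zero cos_gt_zero tan_gt_zero)
  have "((\<lambda>\<theta>. b + ln (tan \<theta>) / a) has_real_derivative
      0 + inverse ((cos \<theta>)\<^sup>2) * (1 / tan \<theta>) / a) (at \<theta> within A)"
    using sc assms(1) by (auto intro!: derivative_eq_intros)
  moreover have "0 + inverse ((cos \<theta>)\<^sup>2) * (1 / tan \<theta>) / a = 1 / (a * sin \<theta> * cos \<theta>)"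
    using sc assms(1) by (simp add: tan_def field_simps power2_eq_square)
  ultimately show ?thesis
    by simp
qed

lemma integral_max_spectral_density:
  assumes "\<beta> > 0" "t \<noteq> 0" "w\<^sub>1 > 0" "w\<^sub>2 > 0"
  shows "(LINT \<theta>:{0<..<pi / 2}|lborel. max (sin \<theta> / w\<^sub>1) (cos \<theta> / w\<^sub>2) * spectral_density \<beta> t \<theta>)
    = 1 / w\<^sub>1 * std_normal_cdf (\<beta> * \<bar>t\<bar> / 2 + 1 / (\<beta> * \<bar>t\<bar>) * ln (w\<^sub>2 / w\<^sub>1))
        + 1 / w\<^sub>2 * std_normal_cdf (\<beta> * \<bar>t\<bar> / 2 + 1 / (\<beta> * \<bar>t\<bar>) * ln (w\<^sub>1 / w\<^sub>2))"
    (is "_ = ?V")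
proof -
  define a where "a = \<beta> * \<bar>t\<bar>"
  define S where "S = {0<..<pi / 2}"
  define g where "g = (\<lambda>\<theta>. a / 2 + ln (tan \<theta>) / a)"
  define g' where "g' = (\<lambda>\<theta>. 1 / (a * sin \<theta> * cos \<theta>))"
  \<comment> \<open>The weights appear in the order \<open>w\<^sub>2\<close>,
    \<open>w\<^sub>1\<close>: after substitution the shifted density carries the factor
    \<open>tan \<theta>\<close>, and taking out \<open>1 / cos \<theta>\<close> leaves
    \<open>cos \<theta>\<close> with the unshifted term and \<open>sin \<theta>\<close> with the
    shifted one.\<close>
  define H where "H = (\<lambda>u. max (1 / w\<^sub>2 * std_normal_density u) (1 / w\<^sub>1 * std_normal_density (u - a)))"
  have a: "a > 0"
    using assms by (simp add: a_def)
  have eq: "max (sin \<theta> / w\<^sub>1) (cos \<theta> / w\<^sub>2) * spectral_density \<beta> t \<theta> = \<bar>g' \<theta>\<bar> * H (g \<theta>)"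
    if "\<theta> \<in> S" for \<theta>
  proof -
    have sc: "sin \<theta> > 0" "cos \<theta> > 0"
      using that by (auto simp: S_def sin_gt_zero cos_gt_zero)
    define D where "D = std_normal_density (g \<theta>)"
    have D: "D \<ge> 0"
      by (simp add: D_def)
    note sd = spectral_density_eq[OF assms(1,2) that[unfolded S_def], folded a_def]
    have "H (g \<theta>) = max (1 / w\<^sub>2 * D) (1 / w\<^sub>1 * (tan \<theta> * D))"
      using sd(2) by (simp add: H_def D_def g_def)
    also have "1 / w\<^sub>2 * D = D / cos \<theta> * (cos \<theta> / w\<^sub>2)"
      using sc by simp
    also have "1 / w\<^sub>1 * (tan \<theta> * D) = D / cos \<theta> * (sin \<theta> / w\<^sub>1)"
      by (simp add: tan_def mult.commute)
    also have "max (D / cos \<theta> * (cos \<theta> / w\<^sub>2)) (D / cos \<theta> * (sin \<theta> / w\<^sub>1))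
        = D / cos \<theta> * max (sin \<theta> / w\<^sub>1) (cos \<theta> / w\<^sub>2)"
      using D sc by (subst max.commute, subst max_mult_distrib_left) auto
    finally have "H (g \<theta>) = D / cos \<theta> * max (sin \<theta> / w\<^sub>1) (cos \<theta> / w\<^sub>2)" .
    moreover have "\<bar>g' \<theta>\<bar> = 1 / (a * sin \<theta> * cos \<theta>)"
      using sc a by (simp add: g'_def abs_mult)
    moreover have "spectral_density \<beta> t \<theta> = D / (a * sin \<theta> * (cos \<theta>)\<^sup>2)"
      using sd(1) by (simp add: D_def g_def)
    ultimately show ?thesis
      by (simp add: power2_eq_square mult_ac)
  qed
  have H: "has_bochner_integral lborel H ?V"
    unfolding H_def using has_bochner_integral_max_std_normal_density[of "1 / w\<^sub>2" "1 / w\<^sub>1" a] assms a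
    by (simp add: a_def add.commute)
  \<comment> \<open>The change of variables is formulated for absolute integrability, that is, over
    the completed Lebesgue measure, so \<open>H\<close> is first transferred there.\<close>
  have H_UNIV: "H absolutely_integrable_on UNIV" "integral UNIV H = ?V"
  proof -
    have "set_integrable lborel UNIV H"
      using H by (simp add: set_integrable_def has_bochner_integral_iff)
    then show "H absolutely_integrable_on UNIV"
      using H by (auto simp: set_integrable_def integrable_completion has_bochner_integral_iff)
    show "integral UNIV H = ?V"
      using H has_integral_integral_lborel[of H] by (auto simp: has_bochner_integral_iff)
  qed
  have S: "S \<in> sets borel"
    by (simp add: S_def)
  have bij: "bij_betw g S UNIV"
    unfolding g_def S_def using a by (rule bij_betw_ln_tan)
  \<comment> \<open>Since \<open>g\<close> maps \<open>S\<close> onto the whole line, the integral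
    over the image is that of \<open>H\<close> over \<open>UNIV\<close>.\<close>
  have "(\<lambda>\<theta>. \<bar>g' \<theta>\<bar> * H (g \<theta>)) absolutely_integrable_on S \<and>
      integral S (\<lambda>\<theta>. \<bar>g' \<theta>\<bar> * H (g \<theta>)) = ?V"
    using bij H_UNIV a S unfolding g_def g'_def
    by (subst has_absolute_integral_change_of_variables_1')
       (auto simp: bij_betw_def S_def intro!: has_real_derivative_ln_tan)
  \<comment> \<open>Borel measurability brings integrability back from the completion to
    \<open>lborel\<close>, where the two notions of integral agree.\<close>
  moreover have "set_borel_measurable lborel S (\<lambda>\<theta>. \<bar>g' \<theta>\<bar> * H (g \<theta>))"
    using S by (simp add: set_borel_measurable_def H_def g_def g'_def tan_def)
  ultimately have "set_integrable lborel S (\<lambda>\<theta>. \<bar>g' \<theta>\<bar> * H (g \<theta>))"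
      and int: "integral S (\<lambda>\<theta>. \<bar>g' \<theta>\<bar> * H (g \<theta>)) = ?V"
    by (auto simp: set_integrable_def set_borel_measurable_def integrable_completion)
  then have "(LINT \<theta>:S|lborel. \<bar>g' \<theta>\<bar> * H (g \<theta>)) = ?V"
    by (simp add: set_borel_integral_eq_integral)
  moreover have "(LINT \<theta>:S|lborel. max (sin \<theta> / w\<^sub>1) (cos \<theta> / w\<^sub>2) * spectral_density \<beta> t \<theta>)
      = (LINT \<theta>:S|lborel. \<bar>g' \<theta>\<bar> * H (g \<theta>))"
    using S eq by (intro set_lebesgue_integral_cong) auto
  ultimately show ?thesis
    by (simp add: S_def)
qed

section \<open>The expression through \<open>chi\<close> and the conclusion\<close>

text \<open>Both arguments in \<open>chi\<close> are negatives of those in the closed form.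
  Reflecting them produces the constants \<open>- 1 / w\<^sub>1\<close> and
  \<open>- 1 / w\<^sub>2\<close>, which cancel the two leading terms.\<close>

lemma chi_identity:
  assumes "w\<^sub>1 > 0" "w\<^sub>2 > 0"
  shows "1 / w\<^sub>1 + 1 / w\<^sub>2 + 1 / w\<^sub>2 * chi \<beta> t (w\<^sub>2 / w\<^sub>1)
    = 1 / w\<^sub>1 * std_normal_cdf (\<beta> * \<bar>t\<bar> / 2 + 1 / (\<beta> * \<bar>t\<bar>) * ln (w\<^sub>2 / w\<^sub>1))
        + 1 / w\<^sub>2 * std_normal_cdf (\<beta> * \<bar>t\<bar> / 2 + 1 / (\<beta> * \<bar>t\<bar>) * ln (w\<^sub>1 / w\<^sub>2))"
proof -
  define x where "x = \<beta> * \<bar>t\<bar> / 2 + 1 / (\<beta> * \<bar>t\<bar>) * ln (w\<^sub>2 / w\<^sub>1)"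
  define y where "y = \<beta> * \<bar>t\<bar> / 2 + 1 / (\<beta> * \<bar>t\<bar>) * ln (w\<^sub>1 / w\<^sub>2)"
  have "ln (w\<^sub>1 / w\<^sub>2) = - ln (w\<^sub>2 / w\<^sub>1)"
    using assms by (simp add: ln_div)
  then have "- (\<bar>t\<bar> * \<beta> / 2) - 1 / (\<bar>t\<bar> * \<beta>) * ln (w\<^sub>2 / w\<^sub>1) = - x"
    "- (\<bar>t\<bar> * \<beta> / 2) + 1 / (\<bar>t\<bar> * \<beta>) * ln (w\<^sub>2 / w\<^sub>1) = - y"
    by (simp_all add: x_def y_def mult.commute)
  then have "chi \<beta> t (w\<^sub>2 / w\<^sub>1) = - (w\<^sub>2 / w\<^sub>1) * (1 - std_normal_cdf x) - (1 - std_normal_cdf y)"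
    unfolding chi_def by (simp only: std_normal_cdf_minus)
  then have "1 / w\<^sub>1 + 1 / w\<^sub>2 + 1 / w\<^sub>2 * chi \<beta> t (w\<^sub>2 / w\<^sub>1)
      = 1 / w\<^sub>1 * std_normal_cdf x + 1 / w\<^sub>2 * std_normal_cdf y"
    using assms by (simp add: diff_divide_distrib right_diff_distrib)
  then show ?thesis
    unfolding x_def y_def .
qed

theorem proposition2p2:
  fixes M :: "'a measure"
    and X Y :: "nat \<Rightarrow> 'a \<Rightarrow> real"
    and Z :: "real \<Rightarrow> 'a \<Rightarrow> ereal"
    and \<beta> t :: real
  assumes "poisson_process M half_plane_lebesgue (\<lambda>j \<omega>. (X j \<omega>, Y j \<omega>))"
    and "Z = moving_maximum (gauss_density \<beta>) X Y"
    and "\<beta> > 0" and "t \<noteq> 0"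
  shows "\<forall>w\<^sub>1>0. \<forall>w\<^sub>2>0.
    let V = - ln (measure M {\<omega> \<in> space M. Z 0 \<omega> \<le> ereal w\<^sub>1 \<and> Z t \<omega> \<le> ereal w\<^sub>2}) in
      V = 1 / w\<^sub>1 * std_normal_cdf (\<beta> * \<bar>t\<bar> / 2 + 1 / (\<beta> * \<bar>t\<bar>) * ln (w\<^sub>2 / w\<^sub>1))
        + 1 / w\<^sub>2 * std_normal_cdf (\<beta> * \<bar>t\<bar> / 2 + 1 / (\<beta> * \<bar>t\<bar>) * ln (w\<^sub>1 / w\<^sub>2)) \<and>
      V = (LINT \<theta>:{0<..<pi / 2}|lborel.
            max (sin \<theta> / w\<^sub>1) (cos \<theta> / w\<^sub>2) * spectral_density \<beta> t \<theta>) \<and>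
      V = 1 / w\<^sub>1 + 1 / w\<^sub>2 + 1 / w\<^sub>2 * chi \<beta> t (w\<^sub>2 / w\<^sub>1)"
proof (intro allI impI)
  fix w\<^sub>1 w\<^sub>2 :: real
  assume w: "w\<^sub>1 > 0" "w\<^sub>2 > 0"
  have "measure M {\<omega> \<in> space M. Z 0 \<omega> \<le> ereal w\<^sub>1 \<and> Z t \<omega> \<le> ereal w\<^sub>2}
    = exp (- (1 / w\<^sub>1 * std_normal_cdf (\<beta> * \<bar>t\<bar> / 2 + 1 / (\<beta> * \<bar>t\<bar>) * ln (w\<^sub>2 / w\<^sub>1))
        + 1 / w\<^sub>2 * std_normal_cdf (\<beta> * \<bar>t\<bar> / 2 + 1 / (\<beta> * \<bar>t\<bar>) * ln (w\<^sub>1 / w\<^sub>2))))"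
    unfolding assms(2)
    using has_bochner_integral_max_gauss_density[OF assms(3,4) w] assms(3)
    by (intro moving_maximum_bivariate_cdf[OF assms(1) _ w]) (simp_all add: gauss_density_def)
  then show "let V = - ln (measure M {\<omega> \<in> space M. Z 0 \<omega> \<le> ereal w\<^sub>1 \<and> Z t \<omega> \<le> ereal w\<^sub>2}) in
      V = 1 / w\<^sub>1 * std_normal_cdf (\<beta> * \<bar>t\<bar> / 2 + 1 / (\<beta> * \<bar>t\<bar>) * ln (w\<^sub>2 / w\<^sub>1))
        + 1 / w\<^sub>2 * std_normal_cdf (\<beta> * \<bar>t\<bar> / 2 + 1 / (\<beta> * \<bar>t\<bar>) * ln (w\<^sub>1 / w\<^sub>2)) \<and>
      V = (LINT \<theta>:{0<..<pi / 2}|lborel.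
            max (sin \<theta> / w\<^sub>1) (cos \<theta> / w\<^sub>2) * spectral_density \<beta> t \<theta>) \<and>
      V = 1 / w\<^sub>1 + 1 / w\<^sub>2 + 1 / w\<^sub>2 * chi \<beta> t (w\<^sub>2 / w\<^sub>1)"
    \<comment> \<open>The spectral integral and the \<open>chi\<close> expression are rewritten to
      the closed form, so all three conjuncts become the same equation, settled by
      \<open>ln_exp\<close>.\<close>
    unfolding Let_def integral_max_spectral_density[OF assms(3,4) w] chi_identity[OF w]
    by (simp only: ln_exp minus_minus simp_thms)
qed

end
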